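(* Let $\mathcal D,\mathcal D_{\mathcal P},\mathcal P,\mathcal O,\mathcal O_{\mathcal D}$, the group $H$, the semigroups $S_{\mathcal D}$ and $\mathcal S_{\mathcal D}$, and the projections $\mathrm{pr}$, $\mathrm{pr}_1$ be as defined in the context. Then: (1) The group $H$ leaves the set $\mathcal D$ invariant. (2) The set $\mathcal D_{\mathcal P}$ is the orbit of $(1,1,0,0)$ under the action of $S_{\mathcal D}$ on $\mathcal D$. (3) The set $\mathcal O_{\mathcal D}$ is the orbit of $\{\frac10,\frac10\}$ under the action of $\mathcal S_{\mathcal D}$ on $\mathcal O_{\mathcal D}$. (4) The projections $\mathrm{pr}:\mathcal D_{\mathcal P}\to\mathcal P$, $\mathrm{pr}:\mathcal O_{\mathcal D}\to\mathcal O$, and $\mathrm{pr}_1:\mathcal O_{\mathcal D}\to\mathcal O$ are bijections.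
   Context: $\mathcal D=\{(k_1,k_2,q_1,q_2)\in\mathbb Z^4\mid k_1k_2-k_1q_2-k_2q_1=1\}$ and $\mathcal D_{\mathcal P}=\{(k_1,k_2,q_1,q_2)\in\mathcal D\mid k_1>0,\ k_2>0,\ 0\le q_1<k_1,\ 0\le q_2<k_2\}$. $\mathbb N$ is the set of positive integers, $\mathcal P=\{(k_1,k_2)\in\mathbb N^2\mid k_1,k_2\text{ coprime}\}$ and $\mathcal O=\{(k_1,k_2)\in\mathcal P\mid k_1\ge k_2\}$. An element $(k_1,k_2)$ of $\mathcal O$ is written $\{k_1,k_2\}$ (larger entry first); $\mathcal O$ is identified with the set of orbits of the swap $(k_1,k_2)\mapsto(k_2,k_1)$ on $\mathcal P$. $h_1,h_2\in GL(4,\mathbb Z)$ are the linear maps acting on column vectors by $h_1(k_1,k_2,q_1,q_2)=(k_1+k_2,\,k_2,\,k_2+q_1-q_2,\,q_2)$ and $h_2(k_1,k_2,q_1,q_2)=(k_2,k_1,q_2,q_1)$. $H\subset GL(4,\mathbb Z)$ is the subgroup generated by $h_1,h_2$ (the image of the free product $\langle x_1,x_2\mid x_2^2=1\rangle$ under $x_1\mapsto h_1$, $x_2\mapsto h_2$), and $S_{\mathcal D}\subset H$ is the sub-semigroup generated by $h_1,h_2$. $\mathcal O_{\mathcal D}$ is the set of orbits of the involution $h_2$ on $\mathcal D_{\mathcal P}$. The orbit of $(k_1,k_2,q_1,q_2)\in\mathcal D_{\mathcal P}$ with $k_1\ge k_2$ is denoted $\{\frac{k_1}{q_1},\frac{k_2}{q_2}\}$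 (the fractions are formal symbols, the denominator may be $0$). $\mathcal S_{\mathcal D}$ is the semigroup freely generated by $\alpha$ and $\beta$, acting on $\mathcal O_{\mathcal D}$ by $\alpha:\{\frac{k_1}{q_1},\frac{k_2}{q_2}\}\mapsto\{\frac{k_1+k_2}{k_2+q_1-q_2},\frac{k_2}{q_2}\}$, $\ \beta:\{\frac{k_1}{q_1},\frac{k_2}{q_2}\}\mapsto\{\frac{k_1+k_2}{k_1+q_2-q_1},\frac{k_1}{q_1}\}$. The orbit of an element contains the element itself. The projections are $\mathrm{pr}:\mathcal D_{\mathcal P}\to\mathcal P$, $\mathrm{pr}(k_1,k_2,q_1,q_2)=(k_1,k_2)$; $\mathrm{pr}:\mathcal O_{\mathcal D}\to\mathcal O$, $\mathrm{pr}(\{\frac{k_1}{q_1},\frac{k_2}{q_2}\})=\{k_1,k_2\}$; and $\mathrm{pr}_1:\mathcal O_{\mathcal D}\to\mathcal O$, $\mathrm{pr}_1(\{\frac{k_1}{q_1},\frac{k_2}{q_2}\})=\{k_1,q_1\}$ (where $k_1\ge k_2$).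
   Formalization: The claim that pr_1 is a bijection onto O fails as stated, since pr_1({1/0,1/0}) = {1,0} is not in O and {1,1} is not a value of pr_1; the formal statement proves that pr_1 is a bijection from O_D onto O with {1,1} replaced by {1,0}. *)

theory Defs
  imports "HOL-Analysis.Analysis" "HOL-Algebra.Generated_Groups"
begin

text \<open>Quadruples \<open>(k1, k2, q1, q2)\<close> are column vectors in \<open>int ^ 4\<close>, with the components in this order.\<close>

definition quad :: "int \<Rightarrow> int \<Rightarrow> int \<Rightarrow> int \<Rightarrow> int ^ 4" where
  "quad k1 k2 q1 q2 = vector [k1, k2, q1, q2]"

definition D :: "(int ^ 4) set" where
  "D = {quad k1 k2 q1 q2 | k1 k2 q1 q2. k1 * k2 - k1 * q2 - k2 * q1 = 1}"

definition DP :: "(int ^ 4) set" where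
  "DP = {quad k1 k2 q1 q2 | k1 k2 q1 q2. quad k1 k2 q1 q2 \<in> D \<and>
           k1 > 0 \<and> k2 > 0 \<and> 0 \<le> q1 \<and> q1 < k1 \<and> 0 \<le> q2 \<and> q2 < k2}"

definition Pcal :: "(int \<times> int) set" where
  "Pcal = {(k1, k2). k1 > 0 \<and> k2 > 0 \<and> coprime k1 k2}"

definition Ocal :: "(int \<times> int) set" where
  "Ocal = {(k1, k2) \<in> Pcal. k1 \<ge> k2}"

definition GL4Z :: "(int ^ 4 ^ 4) monoid" where
  "GL4Z = \<lparr>carrier = {A. invertible A}, mult = (**), one = mat 1\<rparr>"

definition h1 :: "int ^ 4 ^ 4" where
  "h1 = vector [vector [1, 1, 0, 0],
                vector [0, 1, 0, 0],
                vector [0, 1, 1, - 1],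
                vector [0, 0, 0, 1]]"

definition h2 :: "int ^ 4 ^ 4" where
  "h2 = vector [vector [0, 1, 0, 0],
                vector [1, 0, 0, 0],
                vector [0, 0, 0, 1],
                vector [0, 0, 1, 0]]"

definition H :: "(int ^ 4 ^ 4) set" where
  "H = generate GL4Z {h1, h2}"

inductive_set SD :: "(int ^ 4 ^ 4) set" where
  SD_h1: "h1 \<in> SD"
| SD_h2: "h2 \<in> SD"
| SD_mult: "A \<in> SD \<Longrightarrow> B \<in> SD \<Longrightarrow> A ** B \<in> SD"

text \<open>For a semigroup without unit, the point itself has to be added to its orbit explicitly.\<close>

definition orbit_SD :: "int ^ 4 \<Rightarrow> (int ^ 4) set" where
  "orbit_SD v = insert v {A *v v | A. A \<in> SD}"

definition h2_orbit :: "int ^ 4 \<Rightarrow> (int ^ 4) set" where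
  "h2_orbit v = {v, h2 *v v}"

definition OD :: "(int ^ 4) set set" where
  "OD = h2_orbit ` DP"

text \<open>\<open>fracs k1 q1 k2 q2\<close> is the orbit written \<open>{k1/q1, k2/q2}\<close>. Every orbit in \<open>OD\<close> contains
  exactly one quadruple with \<open>k1 \<ge> k2\<close> (if \<open>k1 = k2\<close>, the quadruple is \<open>(1, 1, 0, 0)\<close>), and the
  maps on \<open>OD\<close> are defined by formulas in this representative.\<close>

definition fracs :: "int \<Rightarrow> int \<Rightarrow> int \<Rightarrow> int \<Rightarrow> (int ^ 4) set" where
  "fracs k1 q1 k2 q2 = h2_orbit (quad k1 k2 q1 q2)"

definition rep :: "(int ^ 4) set \<Rightarrow> int ^ 4" where
  "rep X = (THE v. v \<in> X \<and> v $ 1 \<ge> v $ 2)"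

definition on_rep :: "(int \<Rightarrow> int \<Rightarrow> int \<Rightarrow> int \<Rightarrow> 'a) \<Rightarrow> (int ^ 4) set \<Rightarrow> 'a" where
  "on_rep f X = f (rep X $ 1) (rep X $ 2) (rep X $ 3) (rep X $ 4)"

definition alpha :: "(int ^ 4) set \<Rightarrow> (int ^ 4) set" where
  "alpha = on_rep (\<lambda>k1 k2 q1 q2. fracs (k1 + k2) (k2 + q1 - q2) k2 q2)"

definition beta :: "(int ^ 4) set \<Rightarrow> (int ^ 4) set" where
  "beta = on_rep (\<lambda>k1 k2 q1 q2. fracs (k1 + k2) (k1 + q2 - q1) k1 q1)"

text \<open>The semigroup freely generated by two letters consists of the nonempty words.\<close>

datatype letter = Alpha | Beta

definition free_SD :: "letter list set" where
  "free_SD = {w. w \<noteq> []}"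

fun letter_act :: "letter \<Rightarrow> (int ^ 4) set \<Rightarrow> (int ^ 4) set" where
  "letter_act Alpha = alpha"
| "letter_act Beta = beta"

definition word_act :: "letter list \<Rightarrow> (int ^ 4) set \<Rightarrow> (int ^ 4) set" where
  "word_act w X = foldr letter_act w X"

definition orbit_free_SD :: "(int ^ 4) set \<Rightarrow> (int ^ 4) set set" where
  "orbit_free_SD X = insert X {word_act w X | w. w \<in> free_SD}"

definition pr :: "int ^ 4 \<Rightarrow> int \<times> int" where
  "pr v = (v $ 1, v $ 2)"

definition pr_orb :: "(int ^ 4) set \<Rightarrow> int \<times> int" where
  "pr_orb = on_rep (\<lambda>k1 k2 q1 q2. (k1, k2))"

definition pr1 :: "(int ^ 4) set \<Rightarrow> int \<times> int" where
  "pr1 = on_rep (\<lambda>k1 k2 q1 q2. (k1, q1))"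

lemma vec4_nth [simp]:
  fixes a b c d :: "'a::zero"
  shows "(vector [a, b, c, d] :: 'a ^ 4) $ 1 = a" "(vector [a, b, c, d] :: 'a ^ 4) $ 2 = b"
    "(vector [a, b, c, d] :: 'a ^ 4) $ 3 = c" "(vector [a, b, c, d] :: 'a ^ 4) $ 4 = d"
  unfolding vector_def by auto

lemma quad_nth [simp]:
  "quad a b c d $ 1 = a" "quad a b c d $ 2 = b" "quad a b c d $ 3 = c" "quad a b c d $ 4 = d"
  by (simp_all add: quad_def)

lemma vec4_eq_iff: "v = w \<longleftrightarrow> v $ 1 = w $ 1 \<and> v $ 2 = w $ 2 \<and> v $ 3 = w $ 3 \<and> v $ 4 = w $ 4"
  for v w :: "'a ^ 4"
  by (simp add: vec_eq_iff forall_4)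

lemma quad_eq_iff [simp]:
  "quad a b c d = quad a' b' c' d' \<longleftrightarrow> a = a' \<and> b = b' \<and> c = c' \<and> d = d'"
  by (simp add: vec4_eq_iff)

lemma quad_in_D: "quad k1 k2 q1 q2 \<in> D \<longleftrightarrow> k1 * k2 - k1 * q2 - k2 * q1 = 1"
  unfolding D_def by (simp only: mem_Collect_eq quad_eq_iff) blast

lemma quad_in_DP: "quad k1 k2 q1 q2 \<in> DP \<longleftrightarrow> k1 * k2 - k1 * q2 - k2 * q1 = 1 \<and>
    k1 > 0 \<and> k2 > 0 \<and> 0 \<le> q1 \<and> q1 < k1 \<and> 0 \<le> q2 \<and> q2 < k2"
  unfolding DP_def by (simp only: mem_Collect_eq quad_eq_iff quad_in_D) blast

lemma h1_quad: "h1 *v quad k1 k2 q1 q2 = quad (k1 + k2) k2 (k2 + q1 - q2) q2"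
  by (simp add: vec4_eq_iff h1_def matrix_vector_mult_def sum_4)

lemma h2_quad: "h2 *v quad k1 k2 q1 q2 = quad k2 k1 q2 q1"
  by (simp add: vec4_eq_iff h2_def matrix_vector_mult_def sum_4)

lemma rep_fracs:
  assumes "quad k1 k2 q1 q2 \<in> DP" "k1 \<ge> k2"
  shows "rep (fracs k1 q1 k2 q2) = quad k1 k2 q1 q2"
proof -
  have *: "k1 * k2 - k1 * q2 - k2 * q1 = 1" "k1 > 0" "k2 > 0" "0 \<le> q1" "q1 < k1" "0 \<le> q2" "q2 < k2"
    using assms(1) unfolding quad_in_DP by blast+
  have swap: "quad k2 k1 q2 q1 = quad k1 k2 q1 q2" if "k2 \<ge> k1"
  proof -
    have eq: "k1 = k2" using that assms(2) by linarith
    have "k1 * (k1 - q2 - q1) = 1" using * eq by (simp add: algebra_simps)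
    then have "k1 = 1" using \<open>k1 > 0\<close> pos_zmult_eq_1_iff by blast
    then show ?thesis unfolding quad_eq_iff using * eq by linarith
  qed
  show ?thesis
    unfolding rep_def fracs_def h2_orbit_def h2_quad
  proof (rule the_equality)
    show "quad k1 k2 q1 q2 \<in> {quad k1 k2 q1 q2, quad k2 k1 q2 q1} \<and> quad k1 k2 q1 q2 $ 2 \<le> quad k1 k2 q1 q2 $ 1"
      using assms(2) by simp
  next
    fix v
    assume v: "v \<in> {quad k1 k2 q1 q2, quad k2 k1 q2 q1} \<and> v $ 2 \<le> v $ 1"
    then consider "v = quad k1 k2 q1 q2" | "v = quad k2 k1 q2 q1" by blast
    then show "v = quad k1 k2 q1 q2"
    proof cases
      case 2
      with v have "k2 \<ge> k1" by (metis quad_nth(1,2))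
      from swap[OF this] 2 show ?thesis by (rule trans[rotated])
    qed
  qed
qed

lemma on_rep_fracs:
  assumes "quad k1 k2 q1 q2 \<in> DP" "k1 \<ge> k2"
  shows "on_rep f (fracs k1 q1 k2 q2) = f k1 k2 q1 q2"
  by (simp add: on_rep_def rep_fracs[OF assms])

lemma group_GL4Z: "group GL4Z"
proof (rule groupI)
  fix A B :: "int ^ 4 ^ 4"
  assume "A \<in> carrier GL4Z" "B \<in> carrier GL4Z"
  then show "A \<otimes>\<^bsub>GL4Z\<^esub> B \<in> carrier GL4Z"
    by (simp add: GL4Z_def invertible_mult)
next
  fix A :: "int ^ 4 ^ 4"
  assume "A \<in> carrier GL4Z"
  then show "\<exists>B\<in>carrier GL4Z. B \<otimes>\<^bsub>GL4Z\<^esub> A = \<one>\<^bsub>GL4Z\<^esub>"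
    by (auto simp: GL4Z_def invertible_def)
qed (auto simp: GL4Z_def matrix_mul_assoc invertible_def)

lemma h_in_GL4Z: "h1 \<in> carrier GL4Z" "h2 \<in> carrier GL4Z"
proof -
  let ?g = "vector [vector [1, - 1, 0, 0], vector [0, 1, 0, 0],
                    vector [0, - 1, 1, 1], vector [0, 0, 0, 1]] :: int ^ 4 ^ 4"
  have "h1 ** ?g = mat 1" "?g ** h1 = mat 1"
    by (simp_all add: vec4_eq_iff h1_def matrix_matrix_mult_def mat_def sum_4)
  then show "h1 \<in> carrier GL4Z" by (auto simp: GL4Z_def invertible_def)
  have "h2 ** h2 = mat 1"
    by (simp add: vec4_eq_iff h2_def matrix_matrix_mult_def mat_def sum_4)
  then show "h2 \<in> carrier GL4Z" by (auto simp: GL4Z_def invertible_def)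
qed

lemma SD_subset_H: "SD \<subseteq> H"
proof
  fix A assume "A \<in> SD"
  then show "A \<in> H"
  proof induction
    case (SD_mult A B)
    then show ?case
      using generate.eng[of A GL4Z "{h1, h2}" B] by (simp add: H_def GL4Z_def)
  qed (auto simp: H_def intro: generate.incl)
qed

text \<open>The value of \<open>pr1\<close> at \<open>{1/0, 1/0}\<close> is \<open>{1, 0}\<close>, and \<open>(1, 0)\<close> is not a pair of positive
  integers; conversely \<open>(1, 1)\<close> is not of the form \<open>(k1, q1)\<close> with \<open>q1 < k1\<close>. So the codomain of
  \<open>pr1\<close> has to be \<open>Ocal\<close> with \<open>(1, 1)\<close> replaced by \<open>(1, 0)\<close>.\<close>

lemma pr1_base: "fracs 1 0 1 0 \<in> OD" "pr1 (fracs 1 0 1 0) = (1, 0)" "(1, 0) \<notin> Ocal"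
proof -
  have b: "quad 1 1 0 0 \<in> DP" by (simp add: quad_in_DP)
  then show "fracs 1 0 1 0 \<in> OD" unfolding fracs_def OD_def by (rule imageI)
  show "pr1 (fracs 1 0 1 0) = (1, 0)" unfolding pr1_def by (subst on_rep_fracs[OF b]) simp_all
  show "(1, 0) \<notin> Ocal" by (simp add: Ocal_def Pcal_def)
qed

lemma pr1_not_bij_Ocal: "\<not> bij_betw pr1 OD Ocal"
  using bij_betwE[of pr1 OD Ocal] pr1_base by metis

end

theory Submission
  imports Defs
begin

text \<open>The form \<open>k1 * k2 - k1 * q2 - k2 * q1\<close> is invariant under \<open>h1\<close> and \<open>h2\<close>, which gives (1).
  Parts (2) and (3) are a Euclidean descent: a quadruple in \<open>DP\<close> with \<open>k1 > k2\<close> has its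
  preimage under \<open>h1\<close> again in \<open>DP\<close>, and \<open>(1, 1, 0, 0)\<close> is the only one with \<open>k1 = k2\<close>.
  For (4), write the equation as \<open>k2 * (k1 - q1) - k1 * q2 = 1\<close>: it says that \<open>k2\<close> and \<open>k1 - q1\<close>
  are inverse to each other modulo \<open>k1\<close>, and both lie in \<open>{1..k1}\<close> when \<open>k2 \<le> k1\<close>, so each
  determines the other, and \<open>q2\<close>.\<close>

section \<open>Inverses modulo a positive integer\<close>

lemma coprime_if_dvd_mult_minus_1:
  fixes a b p :: int
  assumes "a dvd b * p - 1"
  shows "coprime a b"
proof (rule coprimeI)
  fix c assume "c dvd a" "c dvd b"
  then have "c dvd b * p" "c dvd b * p - 1"
    using assms by (auto intro: dvd_trans)
  then have "c dvd b * p - (b * p - 1)" by (rule dvd_diff)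
  then show "is_unit c" by simp
qed

text \<open>Being a unit modulo \<open>a\<close>, \<open>b\<close> can be cancelled, so
  \<open>a\<close> divides \<open>p - p'\<close>; the range \<open>{1..a}\<close> is too short for a
  nonzero multiple of \<open>a\<close>.\<close>

lemma mod_inverse_unique:
  fixes a b p p' :: int
  assumes "a dvd b * p - 1" "a dvd b * p' - 1" "0 < p" "p \<le> a" "0 < p'" "p' \<le> a"
  shows "p = p'"
proof -
  have "a dvd (b * p - 1) - (b * p' - 1)" using assms(1,2) by (rule dvd_diff)
  then have "a dvd b * (p - p')" by (simp add: algebra_simps)
  then have "a dvd p - p'"
    using coprime_if_dvd_mult_minus_1[OF assms(1)] by (simp add: coprime_dvd_mult_right_iff)
  moreover have "\<bar>p - p'\<bar> < \<bar>a\<bar>" using assms(3-6) by linarith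
  ultimately have "p - p' = 0" using dvd_imp_le_int by (metis linorder_not_less)
  then show ?thesis by simp
qed

lemma coprime_diff_right_iff: "coprime a (a - b) \<longleftrightarrow> coprime a b"
  for a b :: int
  by (simp only: coprime_iff_gcd_eq_1 gcd.commute[of a] gcd_diff2)

lemma mod_inverse_exists:
  fixes a b :: int
  assumes "coprime a b" "a > 0"
  obtains p where "0 < p" "p \<le> a" "a dvd b * p - 1"
proof -
  obtain x y where xy: "a * x + b * y = 1"
    using bezout_int[of a b] assms(1) by (auto simp: mult.commute)
  \<comment> \<open>The Bezout coefficient is reduced to the residues \<open>{1..a}\<close>, not
    \<open>{0..a-1}\<close>: for \<open>a = 1\<close> this gives \<open>p = 1\<close>, and
    \<open>p = k1 - q1\<close> must stay positive.\<close>
  define p where "p = (y - 1) mod a + 1"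
  define t where "t = (y - 1) div a"
  have "y = p + a * t"
    using div_mult_mod_eq[of "y - 1" a] by (simp add: p_def t_def algebra_simps)
  then have "b * p - 1 = a * (- x - b * t)"
    using xy by (simp add: algebra_simps)
  then have "a dvd b * p - 1" by simp
  moreover have "0 < p" "p \<le> a"
    using pos_mod_bound[OF assms(2), of "y - 1"] pos_mod_sign[OF assms(2), of "y - 1"]
    unfolding p_def by linarith+
  ultimately show ?thesis by (rule that[rotated 2])
qed

text \<open>The bounds on \<open>q2\<close> come for free: \<open>k2 * (k1 - q1) - 1\<close> lies
  between \<open>0\<close> and \<open>k2 * k1 - 1\<close>, so its quotient by \<open>k1\<close> lies
  in \<open>{0..<k2}\<close>.\<close>

lemma quad_in_DP_iff_mod_inverse:
  assumes "k1 > 0" "k2 > 0"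
  shows "quad k1 k2 q1 q2 \<in> DP \<longleftrightarrow>
    0 < k1 - q1 \<and> k1 - q1 \<le> k1 \<and> k2 * (k1 - q1) - 1 = k1 * q2"
proof
  assume "quad k1 k2 q1 q2 \<in> DP"
  then show "0 < k1 - q1 \<and> k1 - q1 \<le> k1 \<and> k2 * (k1 - q1) - 1 = k1 * q2"
    by (auto simp: quad_in_DP algebra_simps)
next
  assume *: "0 < k1 - q1 \<and> k1 - q1 \<le> k1 \<and> k2 * (k1 - q1) - 1 = k1 * q2"
  then have "k2 * (k1 - q1) > 0" using assms by simp
  then have "k1 * q2 \<ge> 0" using * by linarith
  then have q2: "q2 \<ge> 0" using assms(1) by (simp add: zero_le_mult_iff)
  have "k2 * (k1 - q1) \<le> k2 * k1" using * assms by (intro mult_left_mono) auto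
  then have "k1 * q2 < k1 * k2" using * by (simp only: mult.commute[of k2 k1]) linarith
  then have "q2 < k2" using assms(1) by simp
  then show "quad k1 k2 q1 q2 \<in> DP" using q2 * assms by (simp add: quad_in_DP algebra_simps)
qed

lemma quad_DP_dvd:
  assumes "quad k1 k2 q1 q2 \<in> DP"
  shows "k1 dvd k2 * (k1 - q1) - 1"
  using assms quad_in_DP_iff_mod_inverse[of k1 k2 q1 q2] by (simp add: quad_in_DP)

lemma quad_DP_snd_unique:
  assumes "quad k1 k2 q1 q2 \<in> DP" "quad k1 k2 q1 q2' \<in> DP"
  shows "q2 = q2'"
proof -
  have "k1 * q2 = k1 * q2'" "k1 > 0" using assms unfolding quad_in_DP by linarith+
  then show ?thesis by simp
qed

section \<open>Swap, forward step and Euclidean descent on \<open>DP\<close>\<close>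

lemma D_E:
  assumes "v \<in> D"
  obtains k1 k2 q1 q2 where "v = quad k1 k2 q1 q2" "k1 * k2 - k1 * q2 - k2 * q1 = 1"
  using assms unfolding D_def by blast

lemma DP_E:
  assumes "v \<in> DP"
  obtains k1 k2 q1 q2 where "v = quad k1 k2 q1 q2" "quad k1 k2 q1 q2 \<in> DP"
  using assms unfolding DP_def by blast

lemma DP_swap: "quad k1 k2 q1 q2 \<in> DP \<Longrightarrow> quad k2 k1 q2 q1 \<in> DP"
  by (auto simp: quad_in_DP algebra_simps)

lemma DP_h1: "quad k1 k2 q1 q2 \<in> DP \<Longrightarrow> quad (k1 + k2) k2 (k2 + q1 - q2) q2 \<in> DP"
  by (auto simp: quad_in_DP algebra_simps)

text \<open>On the diagonal the equation has the factor \<open>k1\<close>, so \<open>k1\<close>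
  divides 1. This is where the descent stops.\<close>

lemma DP_diagonal:
  assumes "quad k1 k2 q1 q2 \<in> DP" "k1 = k2"
  shows "quad k1 k2 q1 q2 = quad 1 1 0 0"
proof -
  have "k1 * (k1 - q2 - q1) = 1" "k1 > 0" using assms by (auto simp: quad_in_DP algebra_simps)
  then have "k1 = 1" using pos_zmult_eq_1_iff by blast
  then show ?thesis using assms by (auto simp: quad_in_DP)
qed

lemma DP_descent:
  assumes "quad k1 k2 q1 q2 \<in> DP" "k2 < k1"
  shows "quad (k1 - k2) k2 (q1 + q2 - k2) q2 \<in> DP"
proof -
  have *: "k1 * k2 - k1 * q2 - k2 * q1 = 1" "k2 > 0" "0 \<le> q2" "q2 < k2"
    using assms(1) by (auto simp: quad_in_DP)
  \<comment> \<open>The equation of the preimage under \<open>h1\<close>, solved for its third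
    entry. Both bounds on that entry are read off here, since \<open>0 < k2 - q2\<close> and
    \<open>k2 - q2 \<le> k2\<close>.\<close>
  have eq: "k2 * (q1 + q2 - k2) = (k1 - k2) * (k2 - q2) - 1"
    using *(1) by (simp add: algebra_simps)
  have "(k1 - k2) * (k2 - q2) > 0" using assms(2) *(4) by simp
  then have "k2 * (q1 + q2 - k2) \<ge> 0" using eq by linarith
  then have nonneg: "q1 + q2 - k2 \<ge> 0" using *(2) by (simp add: zero_le_mult_iff)
  have "(k1 - k2) * (k2 - q2) \<le> (k1 - k2) * k2" using assms(2) *(3) by (intro mult_left_mono) auto
  then have "k2 * (q1 + q2 - k2) < k2 * (k1 - k2)" using eq by (simp add: mult.commute)
  then have "q1 + q2 - k2 < k1 - k2" using *(2) by (metis mult_less_cancel_left_pos)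
  then show ?thesis using nonneg eq * assms(2) by (simp add: quad_in_DP algebra_simps)
qed

section \<open>Invariance of \<open>D\<close> under the group\<close>

lemma h1_image_D: "(\<lambda>v. h1 *v v) ` D = D"
proof
  show "(\<lambda>v. h1 *v v) ` D \<subseteq> D"
    by (auto elim!: D_E simp: h1_quad quad_in_D algebra_simps)
  show "D \<subseteq> (\<lambda>v. h1 *v v) ` D"
  proof
    fix v assume "v \<in> D"
    then obtain k1 k2 q1 q2 where v: "v = quad k1 k2 q1 q2" "k1 * k2 - k1 * q2 - k2 * q1 = 1"
      by (rule D_E)
    show "v \<in> (\<lambda>v. h1 *v v) ` D"
    proof
      show "v = h1 *v quad (k1 - k2) k2 (q1 + q2 - k2) q2" by (simp add: v h1_quad)
      show "quad (k1 - k2) k2 (q1 + q2 - k2) q2 \<in> D"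
        using v(2) by (simp add: quad_in_D algebra_simps)
    qed
  qed
qed

lemma h2_image_D: "(\<lambda>v. h2 *v v) ` D = D"
proof
  show sub: "(\<lambda>v. h2 *v v) ` D \<subseteq> D"
    by (auto elim!: D_E simp: h2_quad quad_in_D algebra_simps)
  show "D \<subseteq> (\<lambda>v. h2 *v v) ` D"
  proof
    fix v assume v: "v \<in> D"
    then have "h2 *v (h2 *v v) = v" by (auto elim!: D_E simp: h2_quad)
    then show "v \<in> (\<lambda>v. h2 *v v) ` D" using sub v by (metis image_eqI image_subset_iff)
  qed
qed

lemma image_mult_eq:
  fixes A B :: "'a::semiring_1 ^ 'n ^ 'n"
  shows "(\<lambda>v. (A ** B) *v v) ` S = (\<lambda>v. A *v v) ` ((\<lambda>v. B *v v) ` S)"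
  by (simp add: image_image matrix_vector_mul_assoc)

text \<open>Induction over generated elements also meets inverses of generators, so equality of
  image and set, not mere inclusion, is what propagates.\<close>

lemma H_image_D:
  assumes "A \<in> H"
  shows "(\<lambda>v. A *v v) ` D = D"
  using assms unfolding H_def
proof induction
  case one
  then show ?case by (simp add: GL4Z_def)
next
  case (incl h)
  then show ?case using h1_image_D h2_image_D by blast
next
  case (inv h)
  then have h: "(\<lambda>v. h *v v) ` D = D" "h \<in> carrier GL4Z"
    using h1_image_D h2_image_D h_in_GL4Z by blast+
  have "inv\<^bsub>GL4Z\<^esub> h ** h = mat 1"
    using group.l_inv[OF group_GL4Z h(2)] by (simp add: GL4Z_def)
  \<comment> \<open>Apply the inverse to both sides of \<open>h(1)\<close>: the image of
    \<open>D\<close> under \<open>h\<close> returns to \<open>D\<close>.\<close>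
  then show ?case using image_mult_eq[of "inv\<^bsub>GL4Z\<^esub> h" h D] h(1) by simp
next
  case (eng g h)
  then show ?case by (simp add: GL4Z_def image_mult_eq)
qed

section \<open>\<open>DP\<close> as an orbit of the matrix semigroup\<close>

lemma orbit_SD_mult:
  assumes "v \<in> orbit_SD w" "A \<in> SD"
  shows "A *v v \<in> orbit_SD w"
  using assms by (auto simp: orbit_SD_def matrix_vector_mul_assoc intro: SD_mult)

lemma DP_SD_invariant:
  assumes "A \<in> SD" "v \<in> DP"
  shows "A *v v \<in> DP"
  using assms
proof (induction arbitrary: v)
  case SD_h1
  from SD_h1.prems show ?case by (rule DP_E) (simp add: h1_quad DP_h1)
next
  case SD_h2
  from SD_h2.prems show ?case by (rule DP_E) (simp add: h2_quad DP_swap)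
next
  case (SD_mult A B)
  then show ?case by (simp flip: matrix_vector_mul_assoc)
qed

lemma quad_DP_in_orbit_SD:
  "quad k1 k2 q1 q2 \<in> DP \<Longrightarrow> quad k1 k2 q1 q2 \<in> orbit_SD (quad 1 1 0 0)"
proof (induction "nat (k1 + k2)" arbitrary: k1 k2 q1 q2 rule: less_induct)
  case less
  \<comment> \<open>Stated for every quadruple with the same sum, because the swap in the case
    \<open>k1 < k2\<close> does not lower the sum and the induction hypothesis does not cover the
    swapped quadruple.\<close>
  have descend: "quad l1 l2 r1 r2 \<in> orbit_SD (quad 1 1 0 0)"
    if l: "quad l1 l2 r1 r2 \<in> DP" "l2 < l1" "l1 + l2 = k1 + k2" for l1 l2 r1 r2
  proof -
    have "l1 > 0" "l2 > 0" using l(1) by (auto simp: quad_in_DP)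
    then have "quad (l1 - l2) l2 (r1 + r2 - l2) r2 \<in> orbit_SD (quad 1 1 0 0)"
      using less(1)[OF _ DP_descent[OF l(1,2)]] l(3) by simp
    from orbit_SD_mult[OF this SD_h1] show ?thesis by (simp add: h1_quad)
  qed
  consider "k2 < k1" | "k1 = k2" | "k1 < k2" by linarith
  then show ?case
  proof cases
    case 1
    then show ?thesis using descend less(2) by blast
  next
    case 2
    then show ?thesis using DP_diagonal[OF less(2)] by (simp add: orbit_SD_def)
  next
    case 3
    then have "quad k2 k1 q2 q1 \<in> orbit_SD (quad 1 1 0 0)"
      using descend DP_swap[OF less(2)] by (simp add: add.commute)
    from orbit_SD_mult[OF this SD_h2] show ?thesis by (simp add: h2_quad)
  qed
qed

lemma DP_eq_orbit_SD: "DP = orbit_SD (quad 1 1 0 0)"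
proof
  show "DP \<subseteq> orbit_SD (quad 1 1 0 0)"
    using quad_DP_in_orbit_SD by (metis DP_E subsetI)
  have "quad 1 1 0 0 \<in> DP" by (simp add: quad_in_DP)
  then show "orbit_SD (quad 1 1 0 0) \<subseteq> DP"
    using DP_SD_invariant by (auto simp: orbit_SD_def)
qed

section \<open>\<open>OD\<close> as an orbit of the free semigroup\<close>

lemma fracs_swap: "fracs k1 q1 k2 q2 = fracs k2 q2 k1 q1"
  by (simp add: fracs_def h2_orbit_def h2_quad insert_commute)

lemma fracs_in_OD: "quad k1 k2 q1 q2 \<in> DP \<Longrightarrow> fracs k1 q1 k2 q2 \<in> OD"
  by (simp add: fracs_def OD_def)

lemma OD_E:
  assumes "X \<in> OD"
  obtains k1 k2 q1 q2 where "X = fracs k1 q1 k2 q2" "quad k1 k2 q1 q2 \<in> DP" "k2 \<le> k1"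
proof -
  obtain v where v: "v \<in> DP" "X = h2_orbit v" using assms by (auto simp: OD_def)
  obtain k1 k2 q1 q2 where q: "v = quad k1 k2 q1 q2" "quad k1 k2 q1 q2 \<in> DP"
    using v(1) by (rule DP_E)
  have X: "X = fracs k1 q1 k2 q2" by (simp add: v(2) q(1) fracs_def)
  show ?thesis
  proof (cases "k2 \<le> k1")
    case True
    then show ?thesis using that X q(2) by blast
  next
    case False
    then show ?thesis using that[of k2 q2 k1 q1] X DP_swap[OF q(2)] fracs_swap by simp
  qed
qed

lemma alpha_fracs:
  assumes "quad k1 k2 q1 q2 \<in> DP" "k2 \<le> k1"
  shows "alpha (fracs k1 q1 k2 q2) = fracs (k1 + k2) (k2 + q1 - q2) k2 q2"
  unfolding alpha_def by (rule on_rep_fracs[OF assms])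

lemma beta_fracs:
  assumes "quad k1 k2 q1 q2 \<in> DP" "k2 \<le> k1"
  shows "beta (fracs k1 q1 k2 q2) = fracs (k1 + k2) (k1 + q2 - q1) k1 q1"
  unfolding beta_def by (rule on_rep_fracs[OF assms])

lemma letter_act_OD:
  assumes "X \<in> OD"
  shows "letter_act a X \<in> OD"
proof -
  obtain k1 k2 q1 q2 where X: "X = fracs k1 q1 k2 q2" and q: "quad k1 k2 q1 q2 \<in> DP" "k2 \<le> k1"
    using assms by (rule OD_E)
  show ?thesis
  proof (cases a)
    case Alpha
    then show ?thesis using fracs_in_OD[OF DP_h1[OF q(1)]] by (simp add: X alpha_fracs[OF q])
  next
    case Beta
    then show ?thesis
      \<comment> \<open>\<open>beta\<close> amounts to \<open>h1\<close> applied to the swapped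
        quadruple of the orbit.\<close>
      using fracs_in_OD[OF DP_h1[OF DP_swap[OF q(1)]]]
      by (simp add: X beta_fracs[OF q] add.commute)
  qed
qed

lemma word_act_OD: "X \<in> OD \<Longrightarrow> word_act w X \<in> OD"
  by (induction w) (simp_all add: word_act_def letter_act_OD)

lemma orbit_free_SD_letter_act:
  assumes "X \<in> orbit_free_SD Y"
  shows "letter_act a X \<in> orbit_free_SD Y"
proof -
  obtain w where "X = word_act w Y"
    \<comment> \<open>The point \<open>Y\<close> itself comes from the empty word, which is not in
      \<open>free_SD\<close>; prepending \<open>a\<close> makes the word nonempty.\<close>
    using assms by (auto simp: orbit_free_SD_def word_act_def intro: that[of "[]"])
  then have "letter_act a X = word_act (a # w) Y" by (simp add: word_act_def)
  moreover have "a # w \<in> free_SD" by (simp add: free_SD_def)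
  ultimately show ?thesis unfolding orbit_free_SD_def by blast
qed

lemma fracs_in_orbit_free_SD:
  "quad k1 k2 q1 q2 \<in> DP \<Longrightarrow> k2 \<le> k1 \<Longrightarrow> fracs k1 q1 k2 q2 \<in> orbit_free_SD (fracs 1 0 1 0)"
proof (induction "nat (k1 + k2)" arbitrary: k1 k2 q1 q2 rule: less_induct)
  case less
  have pos: "k1 > 0" "k2 > 0" using less(2) by (auto simp: quad_in_DP)
  let ?q = "q1 + q2 - k2"
  show ?case
  proof (cases "k1 = k2")
    case True
    then show ?thesis using DP_diagonal[OF less(2)] by (simp add: orbit_free_SD_def)
  next
    case False
    then have pred: "quad (k1 - k2) k2 ?q q2 \<in> DP" using DP_descent less(2,3) by simp
    show ?thesis
    \<comment> \<open>The letter to be undone depends on the order in the predecessor: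
      \<open>alpha\<close> if \<open>k2\<close> is still the smaller entry (or equal),
      \<open>beta\<close> if it has become the larger one.\<close>
    proof (cases "k2 \<le> k1 - k2")
      case True
      then have "fracs (k1 - k2) ?q k2 q2 \<in> orbit_free_SD (fracs 1 0 1 0)"
        using less(1)[OF _ pred] pos by simp
      from orbit_free_SD_letter_act[OF this, of Alpha]
      show ?thesis by (simp add: alpha_fracs[OF pred True])
    next
      case False
      then have le: "k1 - k2 \<le> k2" by simp
      then have "fracs k2 q2 (k1 - k2) ?q \<in> orbit_free_SD (fracs 1 0 1 0)"
        using less(1)[OF _ DP_swap[OF pred]] pos by simp
      from orbit_free_SD_letter_act[OF this, of Beta]
      show ?thesis by (simp add: beta_fracs[OF DP_swap[OF pred] le])
    qed
  qed
qed

lemma OD_eq_orbit_free_SD: "OD = orbit_free_SD (fracs 1 0 1 0)"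
proof
  show "OD \<subseteq> orbit_free_SD (fracs 1 0 1 0)"
    using fracs_in_orbit_free_SD by (metis OD_E subsetI)
  show "orbit_free_SD (fracs 1 0 1 0) \<subseteq> OD"
    using word_act_OD[OF pr1_base(1)] pr1_base(1) by (auto simp: orbit_free_SD_def)
qed

section \<open>Bijectivity of the projections\<close>

lemma quad_DP_eqI:
  assumes "quad k1 k2 q1 q2 \<in> DP" "quad k1 k2 q1' q2' \<in> DP"
  shows "q1 = q1' \<and> q2 = q2'"
proof -
  have "k1 - q1 = k1 - q1'"
    using assms by (intro mod_inverse_unique[OF quad_DP_dvd quad_DP_dvd]) (auto simp: quad_in_DP)
  then show ?thesis using quad_DP_snd_unique assms by auto
qed

text \<open>Take \<open>q1 = k1 - p\<close> with \<open>p\<close> the inverse of \<open>k2\<close>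
  modulo \<open>k1\<close>; the quotient in the divisibility is \<open>q2\<close>.\<close>

lemma quad_DP_exists:
  assumes "(k1, k2) \<in> Pcal"
  obtains q1 q2 where "quad k1 k2 q1 q2 \<in> DP"
proof -
  have k: "k1 > 0" "k2 > 0" "coprime k1 k2" using assms by (auto simp: Pcal_def)
  obtain p where p: "0 < p" "p \<le> k1" "k1 dvd k2 * p - 1"
    using mod_inverse_exists k by blast
  then obtain q2 where "k2 * p - 1 = k1 * q2" by (auto elim: dvdE)
  then have "quad k1 k2 (k1 - p) q2 \<in> DP"
    using k p by (simp add: quad_in_DP_iff_mod_inverse)
  then show ?thesis by (rule that)
qed

lemma quad_DP_Pcal: "quad k1 k2 q1 q2 \<in> DP \<Longrightarrow> (k1, k2) \<in> Pcal"
  using coprime_if_dvd_mult_minus_1[OF quad_DP_dvd] by (auto simp: Pcal_def quad_in_DP)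

lemma bij_betw_pr: "bij_betw pr DP Pcal"
  unfolding bij_betw_def
proof
  show "inj_on pr DP"
    unfolding inj_on_def pr_def by (metis DP_E Pair_inject quad_DP_eqI quad_nth(1,2))
  show "pr ` DP = Pcal"
  proof
    show "pr ` DP \<subseteq> Pcal"
    proof (rule image_subsetI)
      fix v assume "v \<in> DP"
      then show "pr v \<in> Pcal" by (rule DP_E) (simp add: pr_def quad_DP_Pcal)
    qed
    show "Pcal \<subseteq> pr ` DP"
    proof (clarify)
      fix k1 k2 assume "(k1, k2) \<in> Pcal"
      then obtain q1 q2 where "quad k1 k2 q1 q2 \<in> DP" by (rule quad_DP_exists)
      then show "(k1, k2) \<in> pr ` DP" by (rule rev_image_eqI) (simp add: pr_def)
    qed
  qed
qed

lemma pr_orb_fracs: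
  assumes "quad k1 k2 q1 q2 \<in> DP" "k2 \<le> k1"
  shows "pr_orb (fracs k1 q1 k2 q2) = (k1, k2)"
  unfolding pr_orb_def by (rule on_rep_fracs[OF assms])

lemma pr1_fracs:
  assumes "quad k1 k2 q1 q2 \<in> DP" "k2 \<le> k1"
  shows "pr1 (fracs k1 q1 k2 q2) = (k1, q1)"
  unfolding pr1_def by (rule on_rep_fracs[OF assms])

lemma bij_betw_pr_orb: "bij_betw pr_orb OD Ocal"
  unfolding bij_betw_def
proof
  show "inj_on pr_orb OD"
  proof (rule inj_onI)
    fix X Y assume X: "X \<in> OD" and Y: "Y \<in> OD" and eq: "pr_orb X = pr_orb Y"
    obtain k1 k2 q1 q2 where X': "X = fracs k1 q1 k2 q2" "quad k1 k2 q1 q2 \<in> DP" "k2 \<le> k1"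
      using X by (rule OD_E)
    obtain k1' k2' q1' q2'
      where Y': "Y = fracs k1' q1' k2' q2'" "quad k1' k2' q1' q2' \<in> DP" "k2' \<le> k1'"
      using Y by (rule OD_E)
    have "k1' = k1" "k2' = k2" using eq X' Y' by (simp_all add: pr_orb_fracs)
    then show "X = Y" using X' Y' quad_DP_eqI by blast
  qed
  show "pr_orb ` OD = Ocal"
  proof
    show "pr_orb ` OD \<subseteq> Ocal"
    proof (rule image_subsetI)
      fix X assume "X \<in> OD"
      then show "pr_orb X \<in> Ocal"
        by (rule OD_E) (simp add: pr_orb_fracs Ocal_def quad_DP_Pcal)
    qed
    show "Ocal \<subseteq> pr_orb ` OD"
    proof (clarify)
      fix k1 k2 assume "(k1, k2) \<in> Ocal"
      then have k: "(k1, k2) \<in> Pcal" "k2 \<le> k1" by (auto simp: Ocal_def)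
      obtain q1 q2 where q: "quad k1 k2 q1 q2 \<in> DP" using k(1) by (rule quad_DP_exists)
      show "(k1, k2) \<in> pr_orb ` OD"
        using pr_orb_fracs[OF q k(2)] fracs_in_OD[OF q] by (metis imageI)
    qed
  qed
qed

text \<open>The argument for \<open>pr\<close> with the roles of \<open>k2\<close> and
  \<open>k1 - q1\<close> exchanged: now \<open>k1 - q1\<close> is given and \<open>k2\<close> is its
  inverse modulo \<open>k1\<close>. The ordering \<open>k2 \<le> k1\<close> puts \<open>k2\<close>
  in the range where the inverse is unique.\<close>

lemma bij_betw_pr1: "bij_betw pr1 OD (insert (1, 0) (Ocal - {(1, 1)}))"
  unfolding bij_betw_def
proof
  show "inj_on pr1 OD"
  proof (rule inj_onI)
    fix X Y assume X: "X \<in> OD" and Y: "Y \<in> OD" and eq: "pr1 X = pr1 Y"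
    obtain k1 k2 q1 q2 where X': "X = fracs k1 q1 k2 q2" "quad k1 k2 q1 q2 \<in> DP" "k2 \<le> k1"
      using X by (rule OD_E)
    obtain k1' k2' q1' q2'
      where Y': "Y = fracs k1' q1' k2' q2'" "quad k1' k2' q1' q2' \<in> DP" "k2' \<le> k1'"
      using Y by (rule OD_E)
    have [simp]: "k1' = k1" "q1' = q1" using eq X' Y' by (simp_all add: pr1_fracs)
    have "k1 dvd (k1 - q1) * k2 - 1" "k1 dvd (k1 - q1) * k2' - 1"
      using quad_DP_dvd[OF X'(2)] quad_DP_dvd[OF Y'(2)] by (simp_all add: mult.commute)
    then have "k2 = k2'"
      by (rule mod_inverse_unique) (use X' Y' in \<open>auto simp: quad_in_DP\<close>)
    then have "q2 = q2'" using X'(2) Y'(2) quad_DP_snd_unique by simp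
    then show "X = Y" using X'(1) Y'(1) \<open>k2 = k2'\<close> by simp
  qed
  show "pr1 ` OD = insert (1, 0) (Ocal - {(1, 1)})"
  proof
    show "pr1 ` OD \<subseteq> insert (1, 0) (Ocal - {(1, 1)})"
    proof (rule image_subsetI)
      fix X assume X: "X \<in> OD"
      obtain k1 k2 q1 q2 where X': "X = fracs k1 q1 k2 q2" "quad k1 k2 q1 q2 \<in> DP" "k2 \<le> k1"
        using X by (rule OD_E)
      have k: "k1 > 0" "0 \<le> q1" "q1 < k1" using X'(2) by (auto simp: quad_in_DP)
      have "k1 dvd (k1 - q1) * k2 - 1" using quad_DP_dvd[OF X'(2)] by (simp add: mult.commute)
      then have "coprime k1 (k1 - q1)" by (rule coprime_if_dvd_mult_minus_1)
      then have cop: "coprime k1 q1" by (simp only: coprime_diff_right_iff)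
      have "(k1, q1) \<in> insert (1, 0) (Ocal - {(1, 1)})"
      \<comment> \<open>If \<open>q1 = 0\<close>, coprimality forces \<open>k1 = 1\<close>, which is
        the extra point \<open>(1, 0)\<close>.\<close>
      proof (cases "q1 = 0")
        case True
        then show ?thesis using cop k by simp
      next
        case False
        then show ?thesis using cop k by (auto simp: Ocal_def Pcal_def)
      qed
      then show "pr1 X \<in> insert (1, 0) (Ocal - {(1, 1)})" using X' by (simp add: pr1_fracs)
    qed
    show "insert (1, 0) (Ocal - {(1, 1)}) \<subseteq> pr1 ` OD"
    proof (rule insert_subsetI)
      show "(1, 0) \<in> pr1 ` OD" using pr1_base(1,2) by (metis imageI)
    next
      show "Ocal - {(1, 1)} \<subseteq> pr1 ` OD"
      proof (rule subrelI)
        fix k1 q1 :: int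
        assume "(k1, q1) \<in> Ocal - {(1, 1)}"
        then have k: "k1 > 0" "q1 > 0" "coprime k1 q1" "q1 \<le> k1" "(k1, q1) \<noteq> (1, 1)"
          by (auto simp: Ocal_def Pcal_def)
        \<comment> \<open>Equal coprime positive entries would give the removed point
          \<open>(1, 1)\<close>.\<close>
        then have "q1 \<noteq> k1" by auto
        then have "q1 < k1" using k by simp
        have "coprime k1 (k1 - q1)"
          using k(3) by (simp only: coprime_diff_right_iff)
        then obtain k2 where k2: "0 < k2" "k2 \<le> k1" "k1 dvd (k1 - q1) * k2 - 1"
          using mod_inverse_exists k(1) by blast
        then obtain q2 where "k2 * (k1 - q1) - 1 = k1 * q2"
          by (auto elim: dvdE simp: mult.commute)
        then have q: "quad k1 k2 q1 q2 \<in> DP"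
          using k k2 \<open>q1 < k1\<close> by (simp add: quad_in_DP_iff_mod_inverse)
        show "(k1, q1) \<in> pr1 ` OD"
          using pr1_fracs[OF q k2(2)] fracs_in_OD[OF q] by (metis imageI)
      qed
    qed
  qed
qed

theorem theorem2:
  shows "(\<forall>A\<in>H. (\<lambda>v. A *v v) ` D = D) \<and>
    DP = orbit_SD (quad 1 1 0 0) \<and>
    OD = orbit_free_SD (fracs 1 0 1 0) \<and>
    bij_betw pr DP Pcal \<and>
    bij_betw pr_orb OD Ocal \<and>
    bij_betw pr1 OD (insert (1, 0) (Ocal - {(1, 1)}))"
  using H_image_D DP_eq_orbit_SD OD_eq_orbit_free_SD bij_betw_pr bij_betw_pr_orb bij_betw_pr1
  by blast

end
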